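(* Let $N\ge 3$, let $A^{(N)}$ be a generator in a stable sandpile $\eta \in \Omega$ that has the form of an $N \times N$ square, let $k\in\{2, \ldots, \lceil N/2 \rceil\}$, and let $v_i \in R_k(A^{(N)}) \setminus C\big(\bigcup_{j=1}^k R_j(A^{(N)}) \big)$. Then $$\mathbb{E}[X(\gamma_i \eta)\mid Y \in A^{(N)}] = \begin{cases} \dfrac{3N^5+15N^4 + 15N^3-15N^2-18N+10(4k^3 - 24k^2 + 23k -6)}{30N^2}, &\text{if } N \text{ is odd,} \\[1.2em] \dfrac{3N^5 + 15N^4 + 15N^3 - 15N^2 - 18N + 20k(2k^2-9k+1)}{30N^2}, &\text{if } N \text{ is even.} \end{cases}$$
   Context: Fix an integer $L\ge 1$ and let $V=\{1,\ldots,L\}^2\subset\mathbb{Z}^2$, labelled $V=\{v_1,\ldots,v_{L^2}\}$. For $v,w\in V$ write $v\sim w$ if $v,w$ are nearest neighbours in $\mathbb{Z}^2$; connectedness of subsets of $V$ refers to this relation. All vertices of $\mathbb{Z}^2\setminus V$ are identified with a single sink; every $v\in V$ has four edges to its lattice neighbours, those leading outside $V$ going to the sink (grains sent there are discarded). A sandpile is a map $\eta:V\to\mathbb{Z}$. $\Omega$ is the set of stable sandpiles, i.e. those with $0\le\eta(v)<4$ for all $v\in V$. A vertex $v$ is critical in $\eta$ if $\eta(v)=3$. A generator in $\eta$ is a connected component (maximal connected set) of the set of critical vertices of $\eta$. The removal operator $\gamma_i$ sets $\eta(v_i)$ to $0$ and leaves all other values unchanged. Toppling a vertex $v\in V$ decreases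 $\eta(v)$ by $4$ and increases $\eta(w)$ by $1$ for each $w\in V$ with $w\sim v$; the toppling is legal if $\eta(v)>3$. Avalanche size: for $\eta\in\Omega$ and $v\in V$, $x(\eta,v)$ is the total number of topplings (counted with multiplicity) in any sequence of legal topplings that starts at the configuration obtained from $\eta$ by adding one grain at $v$ and ends at a stable configuration; this number is finite and independent of the sequence. $Y$ is uniformly distributed on $V$ (the vertex where the next grain lands) and $X(\eta)=x(\eta,Y)$, so for nonempty $B\subseteq V$, $\mathbb{E}[X(\eta)\mid Y\in B]=\frac{1}{|B|}\sum_{v\in B}x(\eta,v)$. Rings: for a square $B$ of side at least $3$, let $\delta^{\mathrm{in}}(B)$ (resp. $C(B)$) be the set of $v\in B$ having exactly one (resp. exactly two) nearest neighbours in $\mathbb{Z}^2$ outside $B$ (so $C(B)$ is the set of the four corners). For an $N\times N$ square $A$ with $N\ge3$ and $m=\lceil N/2\rceil$: $R_m(A)=\delta^{\mathrm{in}}(A)\cup C(A)$; for $j=m-1,\ldots,2$, $R_j(A)=\delta^{\mathrm{in}}(A_j)\cup C(A_j)$ with $A_j=A\setminus\bigcup_{k=j+1}^{m}R_k(A)$; and $R_1(A)=A\setminus\bigcup_{k=2}^{m}R_k(A)$. Thus $\bigcup_{j=1}^k R_j(A)$ is a concentric sub-square of $A$ with outermost layer $R_k(A)$. *)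

theory Defs
  imports "HOL-Probability.Probability"
begin

type_synonym vertex = "int \<times> int"

(* A map V \<rightarrow> \<int> is encoded as a total function; Omega below consists of functions that are
   "undefined" outside V, so that its elements correspond one-to-one to such maps. *)
type_synonym sandpile = "vertex \<Rightarrow> int"

definition V :: "nat \<Rightarrow> vertex set" where
  "V L = {1..int L} \<times> {1..int L}"

definition nn :: "vertex \<Rightarrow> vertex \<Rightarrow> bool" where
  "nn v w \<longleftrightarrow> \<bar>fst v - fst w\<bar> + \<bar>snd v - snd w\<bar> = 1"

definition Omega :: "nat \<Rightarrow> sandpile set" where
  "Omega L = V L \<rightarrow>\<^sub>E {0..<4}"

definition critical :: "nat \<Rightarrow> sandpile \<Rightarrow> vertex set" where
  "critical L \<eta> = {v \<in> V L. \<eta> v = 3}"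

definition lattice_connected :: "vertex set \<Rightarrow> bool" where
  "lattice_connected S \<longleftrightarrow>
     S \<noteq> {} \<and> (\<forall>v\<in>S. \<forall>w\<in>S. (\<lambda>a b. a \<in> S \<and> b \<in> S \<and> nn a b)\<^sup>*\<^sup>* v w)"

definition generator :: "nat \<Rightarrow> sandpile \<Rightarrow> vertex set \<Rightarrow> bool" where
  "generator L \<eta> A \<longleftrightarrow>
     A \<subseteq> critical L \<eta> \<and> lattice_connected A \<and>
     (\<forall>B. A \<subseteq> B \<longrightarrow> B \<subseteq> critical L \<eta> \<longrightarrow> lattice_connected B \<longrightarrow> B = A)"

(* The operator gamma_i, indexed by the vertex v_i itself instead of by its label i. *)
definition removal :: "vertex \<Rightarrow> sandpile \<Rightarrow> sandpile" where
  "removal v \<eta> = \<eta>(v := 0)"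

definition add_grain :: "vertex \<Rightarrow> sandpile \<Rightarrow> sandpile" where
  "add_grain v \<eta> = \<eta>(v := \<eta> v + 1)"

(* A vertex at the border of V also loses 4 grains; those not passed on inside V go to the sink. *)
definition topple :: "nat \<Rightarrow> vertex \<Rightarrow> sandpile \<Rightarrow> sandpile" where
  "topple L v \<eta> =
     (\<lambda>w. if w = v then \<eta> w - 4 else if w \<in> V L \<and> nn v w then \<eta> w + 1 else \<eta> w)"

definition legal_toppling :: "nat \<Rightarrow> sandpile \<Rightarrow> sandpile \<Rightarrow> bool" where
  "legal_toppling L \<eta> \<zeta> \<longleftrightarrow> (\<exists>v\<in>V L. \<eta> v > 3 \<and> \<zeta> = topple L v \<eta>)"

(* x(\<eta>,v): the length of any stabilizing sequence of legal topplings. The description is proper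
   because every such sequence has the same length (abelian property) and one exists. *)
definition avalanche_size :: "nat \<Rightarrow> sandpile \<Rightarrow> vertex \<Rightarrow> nat" where
  "avalanche_size L \<eta> v =
     (THE n. \<exists>\<zeta>\<in>Omega L. (legal_toppling L ^^ n) (add_grain v \<eta>) \<zeta>)"

(* E[X(\<eta>) | Y \<in> B] with Y uniform on V and X(\<eta>) = x(\<eta>,Y). *)
definition expected_avalanche_given :: "nat \<Rightarrow> sandpile \<Rightarrow> vertex set \<Rightarrow> real" where
  "expected_avalanche_given L \<eta> B =
     measure_pmf.expectation (cond_pmf (pmf_of_set (V L)) B)
       (\<lambda>y. real (avalanche_size L \<eta> y))"

definition is_square :: "nat \<Rightarrow> vertex set \<Rightarrow> bool" where
  "is_square N A \<longleftrightarrow> (\<exists>a b. A = {a..<a + int N} \<times> {b..<b + int N})"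

definition inner_boundary :: "vertex set \<Rightarrow> vertex set" where
  "inner_boundary B = {v \<in> B. card {w. nn v w \<and> w \<notin> B} = 1}"

definition corners :: "vertex set \<Rightarrow> vertex set" where
  "corners B = {v \<in> B. card {w. nn v w \<and> w \<notin> B} = 2}"

definition num_rings :: "nat \<Rightarrow> nat" where
  "num_rings N = nat \<lceil>real N / 2\<rceil>"

(* ring N A j is R_j(A) for an N \<times> N square A, by downward recursion from the outermost ring
   j = num_rings N. Only indices 1 \<le> j \<le> num_rings N and N \<ge> 3 are meaningful. *)
function ring :: "nat \<Rightarrow> vertex set \<Rightarrow> nat \<Rightarrow> vertex set" where
  "ring N A j =
     (let A\<^sub>j = A - (\<Union>k\<in>{j<..num_rings N}. ring N A k)
      in if j = 1 then A\<^sub>j else inner_boundary A\<^sub>j \<union> corners A\<^sub>j)"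
  by pat_completeness auto
termination
  by (relation "Wellfounded.measure (\<lambda>(N, A, j). num_rings N - j)") auto

declare ring.simps [simp del]

end

theory Submission
  imports Defs
begin

text \<open>
  Write \<open>d w\<close> for the depth of a vertex \<open>w\<close> of the square \<open>A\<close> (1 on the outermost layer, growing
  inwards), \<open>h\<close> for the emptied vertex, \<open>D\<close> for its depth, and \<open>h'\<close> for the one neighbour of \<open>h\<close> of
  depth \<open>D + 1\<close>, which exists because \<open>h\<close> is not a corner of its layer.

  An avalanche started at \<open>y\<close> is a succession of waves. Without the hole, the \<open>j\<close>-th wave topples each
  vertex of depth at least \<open>j\<close> once, and the waves stop when the layer of \<open>y\<close> has become the outermost
  active one, so \<open>w\<close> topples \<open>min (d w) (d y)\<close> times. The hole changes three things. A grain
  dropped on \<open>h\<close> causes no toppling. When wave \<open>D\<close> is the last one, \<open>h\<close> receives one grain too few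
  from it and misses that toppling; when wave \<open>D + 1\<close> follows, \<open>h\<close> makes it up. And
  for \<open>y = h'\<close> the missing grain of \<open>h\<close> leaves \<open>y\<close> stable after wave \<open>D\<close>, so wave \<open>D + 1\<close> does not start.
  These numbers are \<open>wave_count\<close>.

  The waves themselves are never followed. By the least action principle the odometer of an
  avalanche is the least nonnegative function that stabilizes the configuration
  (\<open>avalanche_size_eq_least_stabilizer\<close>), so it suffices that \<open>wave_count\<close> stabilizes
  (\<open>wave_count_stabilizing\<close>) and lies below every stabilizing function
  (\<open>wave_count_le_superharmonic\<close>). The latter is a discrete minimum principle: on critical vertices a
  stabilizing function is superharmonic, strictly so at \<open>y\<close>, and hence it cannot keep a minimum on
  a region that is connected to \<open>y\<close>.

  For the sum over \<open>y\<close> let \<open>s i = N + 2 - 2 i\<close> be the side of the square of depth at least \<open>i\<close>. Counting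
  pairs \<open>(w, y)\<close> by levels, the sum of \<open>min (d w) (d y)\<close> is \<open>\<Sum>i. s i ^ 4\<close>. The corrections amount to
  subtracting \<open>\<Sum>i\<le>D + 1. s i ^ 2\<close> and the \<open>4 (s D - 1)\<close> vertices of the layer of \<open>h\<close>
  (\<open>total_wave_count\<close>). The rings are the layers (\<open>ring_eq_layer\<close>), so \<open>D = num_rings N - k + 1\<close>, and
  summing powers gives the two closed forms.
\<close>

section \<open>The least action principle\<close>

definition neighbour_sum :: "(vertex \<Rightarrow> int) \<Rightarrow> vertex \<Rightarrow> int" where
  "neighbour_sum u w = u (fst w + 1, snd w) + u (fst w - 1, snd w) + u (fst w, snd w + 1) + u (fst w, snd w - 1)"

definition stabilizes :: "nat \<Rightarrow> sandpile \<Rightarrow> (vertex \<Rightarrow> int) \<Rightarrow> bool" where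
  "stabilizes L \<sigma> u \<longleftrightarrow> (\<forall>w. 0 \<le> u w) \<and> (\<forall>w. w \<notin> V L \<longrightarrow> u w = 0) \<and>
     (\<forall>w\<in>V L. \<sigma> w - 4 * u w + neighbour_sum u w \<le> 3)"

lemma finite_V: "finite (V L)"
  by (simp add: V_def)

lemma nn_cases: "nn w z \<longleftrightarrow> z = (fst w + 1, snd w) \<or> z = (fst w - 1, snd w) \<or>
    z = (fst w, snd w + 1) \<or> z = (fst w, snd w - 1)"
  unfolding nn_def by (cases w; cases z) (simp; presburger)

lemma nn_sym: "nn v w \<longleftrightarrow> nn w v"
  unfolding nn_def by linarith

lemma neighbour_sum_mono: "(\<And>w. u w \<le> T w) \<Longrightarrow> neighbour_sum u w \<le> neighbour_sum T w"
  unfolding neighbour_sum_def by (intro add_mono) auto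

lemma neighbour_sum_increment: "neighbour_sum (u(v := u v + 1)) w = neighbour_sum u w + (if nn v w then 1 else 0)"
proof -
  have "nn v w \<longleftrightarrow> nn w v" by (rule nn_sym)
  then show ?thesis
    unfolding neighbour_sum_def nn_cases[of w] by (cases v; cases w) auto
qed

definition odometer :: "nat \<Rightarrow> sandpile \<Rightarrow> nat \<Rightarrow> sandpile \<Rightarrow> (vertex \<Rightarrow> int) \<Rightarrow> bool" where
  "odometer L \<sigma> n \<zeta> u \<longleftrightarrow> (\<forall>w. 0 \<le> u w) \<and> (\<forall>w. w \<notin> V L \<longrightarrow> u w = 0) \<and>
    (\<forall>w\<in>V L. \<zeta> w = \<sigma> w - 4 * u w + neighbour_sum u w) \<and> (\<forall>w. w \<notin> V L \<longrightarrow> \<zeta> w = \<sigma> w) \<and>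
    (\<forall>w\<in>V L. 0 \<le> \<zeta> w) \<and> int n = sum u (V L)"

text \<open>
  Least action: a legal sequence never topples \<open>v\<close> more often than a stabilizing \<open>T\<close> does. At
  the first toppling to do so, \<open>v\<close> would have toppled \<open>T v\<close> times and its neighbours at most as
  often as in \<open>T\<close>, so it would hold at most the 3 grains that \<open>T\<close> leaves there and could not topple.
\<close>

lemma legal_odometer:
  assumes "(legal_toppling L ^^ n) \<sigma> \<zeta>" and nonneg: "\<forall>w\<in>V L. 0 \<le> \<sigma> w"
  obtains u where "odometer L \<sigma> n \<zeta> u" "\<And>T w. stabilizes L \<sigma> T \<Longrightarrow> u w \<le> T w"
proof -
  have "\<exists>u. odometer L \<sigma> n \<zeta> u \<and> (\<forall>T w. stabilizes L \<sigma> T \<longrightarrow> u w \<le> T w)"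
    using assms(1)
  proof (induction n arbitrary: \<zeta>)
    case 0
    have "odometer L \<sigma> 0 \<zeta> (\<lambda>_. 0)"
      using 0 nonneg by (simp add: odometer_def neighbour_sum_def)
    then show ?case by (intro exI[of _ "\<lambda>_. 0"]) (auto simp: stabilizes_def)
  next
    case (Suc n)
    then obtain \<xi> where \<xi>: "(legal_toppling L ^^ n) \<sigma> \<xi>" and step: "legal_toppling L \<xi> \<zeta>"
      by auto
    obtain v where v: "v \<in> V L" "\<xi> v > 3" and \<zeta>: "\<zeta> = topple L v \<xi>"
      using step unfolding legal_toppling_def by auto
    obtain u where odo: "odometer L \<sigma> n \<xi> u"
      and least: "\<And>T w. stabilizes L \<sigma> T \<Longrightarrow> u w \<le> T w"
      using Suc.IH[OF \<xi>] by auto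
    let ?u = "u(v := u v + 1)"
    have \<xi>v: "\<xi> v = \<sigma> v - 4 * u v + neighbour_sum u v" using odo v(1) by (simp add: odometer_def)
    have total: "int (Suc n) = sum ?u (V L)"
    proof -
      have "sum ?u (V L) = sum u (V L) + 1"
        using v(1) finite_V by (simp add: sum.remove[of "V L" v])
      moreover have "int n = sum u (V L)" using odo unfolding odometer_def by blast
      ultimately show ?thesis by simp
    qed
    have inside: "\<zeta> w = \<sigma> w - 4 * ?u w + neighbour_sum ?u w \<and> 0 \<le> \<zeta> w" if "w \<in> V L" for w
    proof -
      have "\<xi> w = \<sigma> w - 4 * u w + neighbour_sum u w" "0 \<le> \<xi> w"
        using odo that unfolding odometer_def by blast+
      then show ?thesis
        using v that by (auto simp: \<zeta> topple_def neighbour_sum_increment nn_def)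
    qed
    have nonneg_u: "0 \<le> ?u w" for w
    proof -
      have "0 \<le> u x" for x using odo unfolding odometer_def by blast
      from this[of v] this[of w] show ?thesis by simp
    qed
    have outside: "?u w = 0 \<and> \<zeta> w = \<sigma> w" if "w \<notin> V L" for w
    proof -
      have "u w = 0" "\<xi> w = \<sigma> w" using odo that unfolding odometer_def by blast+
      then show ?thesis using v(1) that by (auto simp: \<zeta> topple_def)
    qed
    have "odometer L \<sigma> (Suc n) \<zeta> ?u"
      unfolding odometer_def
    proof (intro conjI allI ballI impI)
      fix w assume w: "w \<in> V L"
      show "\<zeta> w = \<sigma> w - 4 * ?u w + neighbour_sum ?u w" by (rule conjunct1[OF inside[OF w]])
      show "0 \<le> \<zeta> w" by (rule conjunct2[OF inside[OF w]])
    next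
      fix w assume w: "w \<notin> V L"
      show "?u w = 0" by (rule conjunct1[OF outside[OF w]])
      show "\<zeta> w = \<sigma> w" by (rule conjunct2[OF outside[OF w]])
    qed (rule nonneg_u total)+
    moreover have "?u w \<le> T w" if T: "stabilizes L \<sigma> T" for T w
    proof (cases "w = v")
      case True
      have "u v < T v"
      proof (rule ccontr)
        assume "\<not> u v < T v"
        then have "u v = T v" using least[OF T, of v] by simp
        moreover have "\<sigma> v - 4 * T v + neighbour_sum T v \<le> 3" using T v(1) by (simp add: stabilizes_def)
        moreover have "neighbour_sum u v \<le> neighbour_sum T v" by (rule neighbour_sum_mono) (rule least[OF T])
        ultimately show False using \<xi>v v(2) by simp
      qed
      then show ?thesis using True by simp
    qed (simp add: least[OF T])
    ultimately show ?case by (intro exI[of _ ?u] conjI allI impI)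
  qed
  then show thesis using that by auto
qed

text \<open>
  Least action bounds the length of legal sequences, so one of maximal length exists, and it ends in
  a stable configuration. The odometer of any sequence ending in a stable configuration is itself stabilizing,
  hence at least \<open>T\<close>, and at most \<open>T\<close> by least action. This gives existence and uniqueness of the length at once.
\<close>

lemma avalanche_size_eq_least_stabilizer:
  assumes config: "add_grain y \<eta> \<in> V L \<rightarrow>\<^sub>E {0..}"
    and T: "stabilizes L (add_grain y \<eta>) T"
    and least: "\<And>u w. stabilizes L (add_grain y \<eta>) u \<Longrightarrow> T w \<le> u w"
  shows "int (avalanche_size L \<eta> y) = sum T (V L)"
proof -
  let ?\<sigma> = "add_grain y \<eta>"
  let ?run = "\<lambda>n \<zeta>. (legal_toppling L ^^ n) ?\<sigma> \<zeta>"
  have nonneg: "\<forall>w\<in>V L. 0 \<le> ?\<sigma> w" using config by (auto simp: PiE_def Pi_def)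
  have outside: "?\<sigma> w = undefined" if "w \<notin> V L" for w
    using PiE_arb[OF config that] .
  have bound: "int n \<le> sum T (V L)" if run: "?run n \<zeta>" for n \<zeta>
    by (rule legal_odometer[OF run nonneg]) (auto simp: odometer_def intro!: sum_mono T)
  have final: "int n = sum T (V L)" if run: "?run n \<zeta>" and \<zeta>: "\<zeta> \<in> Omega L" for n \<zeta>
  proof -
    obtain u where u: "odometer L ?\<sigma> n \<zeta> u" and le: "\<And>w. u w \<le> T w"
      using legal_odometer[OF run nonneg] T by metis
    have "\<zeta> w \<le> 3" if "w \<in> V L" for w using PiE_mem[OF \<zeta>[unfolded Omega_def] that] by simp
    then have "stabilizes L ?\<sigma> u" using u unfolding stabilizes_def odometer_def by simp
    then have "u = T" using least le by (intro ext) (simp add: antisym)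
    then show ?thesis using u by (simp add: odometer_def)
  qed
  have ex: "\<exists>n. \<exists>\<zeta>\<in>Omega L. ?run n \<zeta>"
  proof -
    let ?I = "{n. \<exists>\<zeta>. ?run n \<zeta>}"
    have "?I \<subseteq> {..nat (sum T (V L))}" using bound by fastforce
    then have fin: "finite ?I" using finite_subset by blast
    have "0 \<in> ?I" by auto
    then have "Max ?I \<in> ?I" using fin Max_in by blast
    then obtain \<zeta> where run: "?run (Max ?I) \<zeta>" by auto
    have "\<zeta> w \<le> 3" if w: "w \<in> V L" for w
    proof (rule ccontr)
      assume "\<not> \<zeta> w \<le> 3"
      then have "legal_toppling L \<zeta> (topple L w \<zeta>)" 
        unfolding legal_toppling_def by (intro bexI[OF _ w]) simp
      then have "?run (Suc (Max ?I)) (topple L w \<zeta>)" using run by auto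
      then have "Suc (Max ?I) \<in> ?I" by blast
      then show False using Max_ge[OF fin] by fastforce
    qed
    moreover have "\<forall>w\<in>V L. 0 \<le> \<zeta> w" "\<forall>w. w \<notin> V L \<longrightarrow> \<zeta> w = undefined"
      by (rule legal_odometer[OF run nonneg]; simp add: odometer_def outside)+
    ultimately have "\<zeta> \<in> Omega L" unfolding Omega_def by (intro PiE_I) force+
    then show ?thesis using run by blast
  qed
  have "\<exists>\<zeta>\<in>Omega L. ?run (avalanche_size L \<eta> y) \<zeta>"
    unfolding avalanche_size_def
  proof (rule theI')
    show "\<exists>!n. \<exists>\<zeta>\<in>Omega L. ?run n \<zeta>"
    proof (rule ex_ex1I)
      show "n = n'" if "\<exists>\<zeta>\<in>Omega L. ?run n \<zeta>" "\<exists>\<zeta>\<in>Omega L. ?run n' \<zeta>" for n n'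
        using that final by (metis of_nat_eq_iff)
    qed (rule ex)
  qed
  then show ?thesis using final by blast
qed

section \<open>Squares, layers and their neighbours\<close>

lemma interval_closed_under_steps:
  fixes P :: "int \<Rightarrow> bool"
  assumes "P i" "i \<in> {l..r}" "j \<in> {l..r}"
    and up: "\<And>x. x \<in> {l..r} \<Longrightarrow> P x \<Longrightarrow> x + 1 \<in> {l..r} \<Longrightarrow> P (x + 1)"
    and down: "\<And>x. x \<in> {l..r} \<Longrightarrow> P x \<Longrightarrow> x - 1 \<in> {l..r} \<Longrightarrow> P (x - 1)"
  shows "P j"
proof (cases "i \<le> j")
  case True
  then have "j \<le> r \<longrightarrow> P j"
  proof (induction rule: int_ge_induct)
    case (step x) then show ?case using up[of x] assms(2) by auto
  qed (use assms in auto)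
  then show ?thesis using assms(3) by simp
next
  case False
  then have "j \<le> i" by simp
  then have "l \<le> j \<longrightarrow> P j"
  proof (induction rule: int_le_induct)
    case (step x) then show ?case using down[of x] assms(2) by auto
  qed (use assms in auto)
  then show ?thesis using assms(3) by simp
qed

text \<open>
  Connectedness of a square without one point, in the form of an invariant that spreads along steps.
  Rows and columns avoiding \<open>h\<close> are connected, and any such row crosses every such column.
  Nothing has to spread from \<open>h\<close> itself, which may also lie outside the square.
\<close>

lemma square_minus_point_connected:
  assumes w: "w \<in> {p..p + s} \<times> {r..r + s}" "w \<noteq> h" and y: "y \<in> {p..p + s} \<times> {r..r + s}" "y \<noteq> h"
    and closed: "\<And>z z'. \<lbrakk>z \<in> {p..p + s} \<times> {r..r + s}; z' \<in> {p..p + s} \<times> {r..r + s}; z \<noteq> h; P z; nn z z'\<rbrakk>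
      \<Longrightarrow> P z'"
    and "P w"
  shows "P y"
proof -
  let ?Q = "{p..p + s} \<times> {r..r + s}"
  have row: "P (i', j)" if "P (i, j)" "(i, j) \<in> ?Q" "i' \<in> {p..p + s}" "j \<noteq> snd h" for i i' j
    by (rule interval_closed_under_steps[of "\<lambda>i. P (i, j)" i p "p + s"])
      (use that in \<open>auto intro: closed[rotated 3] simp: nn_def\<close>)
  have col: "P (i, j')" if "P (i, j)" "(i, j) \<in> ?Q" "j' \<in> {r..r + s}" "i \<noteq> fst h" for i j j'
    by (rule interval_closed_under_steps[of "\<lambda>j. P (i, j)" j r "r + s"])
      (use that in \<open>auto intro: closed[rotated 3] simp: nn_def\<close>)
  obtain i j where wij: "w = (i, j)" by (cases w)
  obtain i' j' where yij: "y = (i', j')" by (cases y)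
  show ?thesis
  proof (cases "s \<le> 0")
    case True
    then have "w = y" using w y unfolding wij yij by auto
    then show ?thesis using \<open>P w\<close> by simp
  next
    case False
    obtain c where c: "c \<in> {p..p + s}" "c \<noteq> fst h"
      using False by (cases "fst h = p") (auto intro: that[of p] that[of "p + 1"])
    obtain e where e: "e \<in> {r..r + s}" "e \<noteq> snd h"
      using False by (cases "snd h = r") (auto intro: that[of r] that[of "r + 1"])
    have from_row: "P y" if f: "f \<in> {r..r + s}" "f \<noteq> snd h" "P (g, f)" "g \<in> {p..p + s}" for f g
    proof (cases "i' = fst h")
      case False
      have "P (i', f)" using row[of g f i'] f y yij by auto
      then show ?thesis using col[of i' f j'] False f y yij by auto
    next
      case True
      then have j': "j' \<noteq> snd h" using y yij by auto
      have "P (c, f)" using row[of g f c] f c by auto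
      then have "P (c, j')" using col[of c f j'] f c y yij by auto
      then show ?thesis using row[of c j' i'] j' c y yij by auto
    qed
    show ?thesis
    proof (cases "j = snd h")
      case False
      then show ?thesis using from_row[of j i] w wij \<open>P w\<close> by auto
    next
      case True
      then have "i \<noteq> fst h" using w wij by auto
      then have "P (i, e)" using col[of i j e] w wij \<open>P w\<close> e by auto
      then show ?thesis using from_row[of e i] e w wij by auto
    qed
  qed
qed

definition depth :: "int \<Rightarrow> int \<Rightarrow> int \<Rightarrow> vertex \<Rightarrow> int" where
  "depth a b n w = min (min (fst w - a + 1) (a + n - fst w)) (min (snd w - b + 1) (b + n - snd w))"

text \<open>
  The square of depth at least \<open>l\<close>, parametrised by its lower left corner and its side minus one, as
  \<open>square_minus_point_connected\<close> expects it.
\<close>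

lemma depth_ge_iff: "l \<le> depth a b n w \<longleftrightarrow>
    w \<in> {a + l - 1..a + l - 1 + (n + 1 - 2 * l)} \<times> {b + l - 1..b + l - 1 + (n + 1 - 2 * l)}"
  unfolding depth_def by (cases w) auto

lemma depth_nn: "nn w z \<Longrightarrow> depth a b n w - 1 \<le> depth a b n z \<and> depth a b n z \<le> depth a b n w + 1"
  unfolding nn_cases depth_def by auto

lemma depth_eqI:
  assumes "a + l - 1 \<le> i" "i \<le> a + n - l" "b + l - 1 \<le> j" "j \<le> b + n - l"
    and "i = a + l - 1 \<or> i = a + n - l \<or> j = b + l - 1 \<or> j = b + n - l"
  shows "depth a b n (i, j) = l"
  using assms unfolding depth_def by (auto simp: min_def)

lemma depth_bounds:
  fixes a b n i j :: int
  defines "l \<equiv> depth a b n (i, j)"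
  shows "a + l - 1 \<le> i" "i \<le> a + n - l" "b + l - 1 \<le> j" "j \<le> b + n - l"
    and "i = a + l - 1 \<or> i = a + n - l \<or> j = b + l - 1 \<or> j = b + n - l"
  unfolding l_def depth_def by (auto simp: min_def)

lemma outward_neighbour:
  obtains z where "nn w z" "depth a b n z = depth a b n w - 1"
proof -
  obtain i j where w: "w = (i, j)" by (cases w)
  note bounds = depth_bounds[where a = a and b = b and n = n and i = i and j = j]
  consider "i = a + depth a b n w - 1" | "i = a + n - depth a b n w"
    | "j = b + depth a b n w - 1" | "j = b + n - depth a b n w"
    using bounds(5) unfolding w by linarith
  then show thesis
  proof cases
    case 1
    have "depth a b n (i - 1, j) = depth a b n w - 1"
      by (rule depth_eqI) (use 1 bounds in \<open>auto simp: w\<close>)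
    then show thesis by (intro that[of "(i - 1, j)"]) (simp_all add: w nn_def)
  next
    case 2
    have "depth a b n (i + 1, j) = depth a b n w - 1"
      by (rule depth_eqI) (use 2 bounds in \<open>auto simp: w\<close>)
    then show thesis by (intro that[of "(i + 1, j)"]) (simp_all add: w nn_def)
  next
    case 3
    have "depth a b n (i, j - 1) = depth a b n w - 1"
      by (rule depth_eqI) (use 3 bounds in \<open>auto simp: w\<close>)
    then show thesis by (intro that[of "(i, j - 1)"]) (simp_all add: w nn_def)
  next
    case 4
    have "depth a b n (i, j + 1) = depth a b n w - 1"
      by (rule depth_eqI) (use 4 bounds in \<open>auto simp: w\<close>)
    then show thesis by (intro that[of "(i, j + 1)"]) (simp_all add: w nn_def)
  qed
qed

lemma depth_le: "2 * depth a b n w \<le> n + 1"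
  using depth_bounds(1,2)[where a = a and b = b and n = n and i = "fst w" and j = "snd w"] by simp

definition layer_corner :: "int \<Rightarrow> int \<Rightarrow> int \<Rightarrow> vertex \<Rightarrow> bool" where
  "layer_corner a b n w \<longleftrightarrow>
     fst w \<in> {a + depth a b n w - 1, a + n - depth a b n w} \<and>
     snd w \<in> {b + depth a b n w - 1, b + n - depth a b n w}"

text \<open>
  Off the corners, a vertex of a layer has one neighbour further out, two in the same layer and one further in.
  This is why corners are special: there the depth is not harmonic, and no neighbour lies further in.
\<close>

lemma inner_neighbour:
  assumes "\<not> layer_corner a b n h"
  obtains h' where "nn h h'" "depth a b n h' = depth a b n h + 1"
    "\<And>w. nn h w \<Longrightarrow> depth a b n w \<ge> depth a b n h + 1 \<Longrightarrow> w = h'"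
    "neighbour_sum (depth a b n) h = 4 * depth a b n h"
proof -
  obtain i j where h: "h = (i, j)" by (cases h)
  define D where "D = depth a b n h"
  note D = depth_bounds(1-4)[where a = a and b = b and n = n and i = i and j = j, folded h, folded D_def]
  note attained = depth_bounds(5)[where a = a and b = b and n = n and i = i and j = j, folded h, folded D_def]
  have noncorner: "\<not> ((i = a + D - 1 \<or> i = a + n - D) \<and> (j = b + D - 1 \<or> j = b + n - D))"
    using assms unfolding layer_corner_def D_def[symmetric] by (simp add: h)
  note goal = that[folded D_def]
  consider "i = a + D - 1" "b + D - 1 < j" "j < b + n - D" "i < a + n - D"
    | "i = a + n - D" "b + D - 1 < j" "j < b + n - D" "a + D - 1 < i"
    | "j = b + D - 1" "a + D - 1 < i" "i < a + n - D" "j < b + n - D"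
    | "j = b + n - D" "a + D - 1 < i" "i < a + n - D" "b + D - 1 < j"
    using attained
  proof (elim disjE)
    assume i: "i = a + D - 1"
    then have "j \<noteq> b + D - 1" "j \<noteq> b + n - D" using noncorner by auto
    then show ?thesis using i D by (intro that(1)) auto
  next
    assume i: "i = a + n - D"
    then have "j \<noteq> b + D - 1" "j \<noteq> b + n - D" using noncorner by auto
    then show ?thesis using i D by (intro that(2)) auto
  next
    assume j: "j = b + D - 1"
    then have "i \<noteq> a + D - 1" "i \<noteq> a + n - D" using noncorner by auto
    then show ?thesis using j D by (intro that(3)) auto
  next
    assume j: "j = b + n - D"
    then have "i \<noteq> a + D - 1" "i \<noteq> a + n - D" using noncorner by auto
    then show ?thesis using j D by (intro that(4)) auto
  qed
  then show thesis
  proof cases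
    case 1
    then have eq: "depth a b n (i + 1, j) = D + 1" "depth a b n (i - 1, j) = D - 1"
      "depth a b n (i, j + 1) = D" "depth a b n (i, j - 1) = D"
      by (intro depth_eqI; linarith)+
    show thesis by (rule goal[of "(i + 1, j)"]) (auto simp: h nn_cases neighbour_sum_def eq)
  next
    case 2
    then have eq: "depth a b n (i + 1, j) = D - 1" "depth a b n (i - 1, j) = D + 1"
      "depth a b n (i, j + 1) = D" "depth a b n (i, j - 1) = D"
      by (intro depth_eqI; linarith)+
    show thesis by (rule goal[of "(i - 1, j)"]) (auto simp: h nn_cases neighbour_sum_def eq)
  next
    case 3
    then have eq: "depth a b n (i, j + 1) = D + 1" "depth a b n (i, j - 1) = D - 1"
      "depth a b n (i + 1, j) = D" "depth a b n (i - 1, j) = D"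
      by (intro depth_eqI; linarith)+
    show thesis by (rule goal[of "(i, j + 1)"]) (auto simp: h nn_cases neighbour_sum_def eq)
  next
    case 4
    then have eq: "depth a b n (i, j + 1) = D - 1" "depth a b n (i, j - 1) = D + 1"
      "depth a b n (i + 1, j) = D" "depth a b n (i - 1, j) = D"
      by (intro depth_eqI; linarith)+
    show thesis by (rule goal[of "(i, j - 1)"]) (auto simp: h nn_cases neighbour_sum_def eq)
  qed
qed

section \<open>The toppling numbers\<close>

text \<open>
  The number of waves that a grain at \<open>y\<close> sets off. A neighbour of \<open>h\<close> is deeper than \<open>h\<close> only if it is
  the inner neighbour.
\<close>

definition reach :: "int \<Rightarrow> int \<Rightarrow> int \<Rightarrow> vertex \<Rightarrow> vertex \<Rightarrow> int" where
  "reach a b n h y = (if nn h y \<and> depth a b n h < depth a b n y then depth a b n h else depth a b n y)"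

definition wave_count :: "int \<Rightarrow> int \<Rightarrow> int \<Rightarrow> vertex \<Rightarrow> vertex \<Rightarrow> vertex \<Rightarrow> int" where
  "wave_count a b n h y w = max 0 (min (depth a b n w) (reach a b n h y)) -
     (if w = h \<and> reach a b n h y = depth a b n h then 1 else 0)"

lemma neighbour_sum_lower:
  assumes "\<And>z. nn w z \<Longrightarrow> c \<le> u z"
  shows "4 * c \<le> neighbour_sum u w"
  using assms[of "(fst w + 1, snd w)"] assms[of "(fst w - 1, snd w)"]
    assms[of "(fst w, snd w + 1)"] assms[of "(fst w, snd w - 1)"]
  unfolding neighbour_sum_def nn_cases by simp

lemma neighbour_sum_lower_strict:
  fixes u :: "vertex \<Rightarrow> int"
  assumes "\<And>z. nn w z \<Longrightarrow> c \<le> u z" "nn w z" "c < u z"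
  shows "4 * c < neighbour_sum u w"
  using assms(1)[of "(fst w + 1, snd w)"] assms(1)[of "(fst w - 1, snd w)"]
    assms(1)[of "(fst w, snd w + 1)"] assms(1)[of "(fst w, snd w - 1)"] assms(2,3)
  unfolding neighbour_sum_def nn_cases by auto

text \<open>
  A second point \<open>y\<close> in the square of depth at least \<open>l\<close> forces its side to be at least 2, so that \<open>w\<close> has
  both a horizontal and a vertical neighbour in it.
\<close>

lemma two_deep_neighbours:
  assumes "l \<le> depth a b n w" "l \<le> depth a b n y" "y \<noteq> w"
  obtains e f where "e \<in> {1, -1}" "f \<in> {1, -1}"
    "l \<le> depth a b n (fst w + e, snd w)" "l \<le> depth a b n (fst w, snd w + f)"
proof -
  have side: "n + 1 - 2 * l \<ge> 1"
    using assms unfolding depth_ge_iff by (cases w; cases y) auto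
  define e :: int where "e = (if fst w = a + l - 1 then 1 else -1)"
  define f :: int where "f = (if snd w = b + l - 1 then 1 else -1)"
  have "l \<le> depth a b n (fst w + e, snd w)" "l \<le> depth a b n (fst w, snd w + f)"
    using assms(1) side unfolding depth_ge_iff e_def f_def by (cases w; auto)+
  then show thesis using that[of e f] by (simp add: e_def f_def)
qed

text \<open>
  The situation at the inner neighbour \<open>w\<close> of the hole \<open>h\<close>: even if \<open>w\<close> is a corner of its own layer, the deficit
  of \<open>h\<close> is outweighed by the two neighbours in the square of \<open>w\<close>.
\<close>

lemma neighbour_sum_two_higher_one_lower:
  fixes u :: "vertex \<Rightarrow> int"
  assumes base: "\<And>z. nn w z \<Longrightarrow> z \<noteq> h \<Longrightarrow> c \<le> u z" and low: "c - 1 \<le> u h"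
    and ef: "e \<in> {1, -1}" "f \<in> {1, -1}"
    and high: "c + 1 \<le> u (fst w + e, snd w)" "c + 1 \<le> u (fst w, snd w + f)"
  shows "4 * c + 1 \<le> neighbour_sum u w"
proof -
  have pair: "2 * c - 1 \<le> u z + u z'" if z: "nn w z" "nn w z'" "z \<noteq> z'" for z z'
  proof -
    consider "z = h" "z' \<noteq> h" | "z \<noteq> h" using z(3) by blast
    then show ?thesis
    proof cases
      case 1
      then show ?thesis using base[OF z(2)] low by simp
    next
      case 2
      then show ?thesis using base[OF z(1)] base[OF z(2)] low by (cases "z' = h") simp_all
    qed
  qed
  have "2 * c - 1 \<le> u (fst w - e, snd w) + u (fst w, snd w - f)"
    by (rule pair) (use ef in \<open>auto simp: nn_def\<close>)
  moreover have "neighbour_sum u w = u (fst w + e, snd w) + u (fst w - e, snd w)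
      + u (fst w, snd w + f) + u (fst w, snd w - f)"
    using ef by (auto simp: neighbour_sum_def)
  ultimately show ?thesis using high by simp
qed

text \<open>
  Induction on the level \<open>j\<close>: \<open>u\<close> is at least \<open>min (d w) j\<close>, except that the bound at \<open>h\<close> is weaker by one
  for \<open>j = D\<close>. Suppose \<open>u w = j\<close> at a vertex of depth at least \<open>j + 1\<close>. All its neighbours have value
  at least \<open>j\<close>, so superharmonicity forces them to have value \<open>j\<close> too. The value \<open>j\<close> therefore
  spreads through the square until it reaches \<open>y\<close>, where the inequality is strict.
  One point, called \<open>g\<close> below, must be kept out of this argument: \<open>h\<close> itself as long as it lies in the
  square (\<open>j < D\<close>), and for \<open>j = D\<close> its inner neighbour \<open>h'\<close>, which is adjacent to the one vertex of deficient
  value. The bound at \<open>g\<close> is then recovered from the bounds at its neighbours.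
\<close>

lemma wave_count_le_superharmonic:
  fixes u :: "vertex \<Rightarrow> int"
  assumes noncorner: "\<not> layer_corner a b n h" and h: "1 \<le> depth a b n h"
    and y: "y \<noteq> h" "1 \<le> depth a b n y"
    and nonneg: "\<And>w. 0 \<le> u w"
    and super: "\<And>w. \<lbrakk>1 \<le> depth a b n w; w \<noteq> h; w \<noteq> y\<rbrakk> \<Longrightarrow> neighbour_sum u w \<le> 4 * u w"
    and start: "neighbour_sum u y + 1 \<le> 4 * u y"
    and hole: "neighbour_sum u h - 3 \<le> 4 * u h"
  shows "wave_count a b n h y w \<le> u w"
proof -
  define d where "d = depth a b n"
  define D where "D = d h"
  define J where "J = reach a b n h y"
  have J: "J = (if nn h y \<and> D < d y then D else d y)"
    by (simp add: J_def reach_def D_def d_def)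
  have D1: "1 \<le> D" using h by (simp add: D_def d_def)
  have lip: "d w - 1 \<le> d z \<and> d z \<le> d w + 1" if "nn w z" for w z
    using depth_nn[OF that] unfolding d_def .
  obtain h' where h': "nn h h'" "d h' = D + 1" and unique: "\<And>w. nn h w \<Longrightarrow> d w \<ge> D + 1 \<Longrightarrow> w = h'"
    and harm: "neighbour_sum d h = 4 * D"
    using inner_neighbour[OF noncorner] unfolding d_def[symmetric] D_def[symmetric] by blast
  have hh': "h \<noteq> h'" using h' D_def by auto
  have J_pos: "1 \<le> J" using J D1 y(2) by (auto simp: d_def)
  have levels: "j \<le> J \<longrightarrow> (\<forall>w. min (d w) j - (if w = h \<and> j = D then 1 else 0) \<le> u w)" if "0 \<le> j" for j
    using that
  proof (induction j rule: int_ge_induct)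
    case base
    show ?case using nonneg D1 by (auto intro: min.coboundedI2)
  next
    case (step j)
    show ?case
    proof
      assume jJ: "j + 1 \<le> J"
      then have "j \<le> J" by simp
      then have IH: "min (d w) j - (if w = h \<and> j = D then 1 else 0) \<le> u w" for w
        using step.IH by blast
      have dy: "j + 1 \<le> d y" using jJ J by (auto split: if_splits)
      \<comment> \<open>The point that the spreading argument has to avoid.\<close>
      define g where "g = (if j = D then h' else h)"
      have yg: "y \<noteq> g"
      proof
        assume "y = g"
        then have "j = D" "y = h'" using y(1) by (auto simp: g_def split: if_splits)
        then have "J = D" using J h' by auto
        then show False using jJ \<open>j = D\<close> by simp
      qed
      \<comment> \<open>A neighbour of value \<open>j - 1\<close> could only be \<open>h\<close> with \<open>j = D\<close>, but then the vertex is \<open>h'\<close>.\<close>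
      have near: "j \<le> u z" if w: "j + 1 \<le> d w" "w \<noteq> g" "nn w z" for w z
      proof -
        have "j \<le> d z" using lip[OF w(3)] w(1) by linarith
        moreover have "\<not> (z = h \<and> j = D)"
        proof
          assume "z = h \<and> j = D"
          then have "w = h'" using unique[of w] w nn_sym by auto
          then show False using w(2) \<open>z = h \<and> j = D\<close> by (simp add: g_def)
        qed
        ultimately show ?thesis using IH[of z] by (auto simp: min_def split: if_splits)
      qed
      have deep: "j + 1 \<le> u w" if w: "j + 1 \<le> d w" "w \<noteq> g" for w
      proof (rule ccontr)
        assume "\<not> j + 1 \<le> u w"
        then have low: "u w \<le> j" by simp
        have "u y \<le> j"
        proof (rule square_minus_point_connected[where P = "\<lambda>z. u z \<le> j" and w = w and y = y and h = g])
          show "w \<in> {a + (j + 1) - 1..a + (j + 1) - 1 + (n + 1 - 2 * (j + 1))} \<times>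
            {b + (j + 1) - 1..b + (j + 1) - 1 + (n + 1 - 2 * (j + 1))}"
            using w(1) unfolding d_def depth_ge_iff .
          show "y \<in> {a + (j + 1) - 1..a + (j + 1) - 1 + (n + 1 - 2 * (j + 1))} \<times>
            {b + (j + 1) - 1..b + (j + 1) - 1 + (n + 1 - 2 * (j + 1))}"
            using dy unfolding d_def depth_ge_iff .
          show "w \<noteq> g" "y \<noteq> g" "u w \<le> j" using w yg low by auto
          fix z z'
          assume "z \<in> {a + (j + 1) - 1..a + (j + 1) - 1 + (n + 1 - 2 * (j + 1))} \<times>
            {b + (j + 1) - 1..b + (j + 1) - 1 + (n + 1 - 2 * (j + 1))}"
            and z: "z \<noteq> g" "u z \<le> j" "nn z z'"
          then have dz: "j + 1 \<le> d z" unfolding d_def depth_ge_iff by blast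
          have "z \<noteq> h"
          proof
            assume "z = h"
            then have "j = D" using z(1) by (auto simp: g_def split: if_splits)
            then show False using dz \<open>z = h\<close> by (simp add: D_def)
          qed
          then have "neighbour_sum u z \<le> 4 * u z"
            using super[of z] start dz step.hyps by (cases "z = y") (auto simp: d_def)
          then have "neighbour_sum u z \<le> 4 * j" using z(2) by linarith
          then show "u z' \<le> j"
            using neighbour_sum_lower_strict[of z j u z'] near[OF dz z(1)] z(3) by fastforce
        qed
        moreover have "4 * j \<le> neighbour_sum u y" by (rule neighbour_sum_lower) (rule near[OF dy yg])
        ultimately show False using start by simp
      qed
      have inner: "j + 1 \<le> u h'" if jD: "j = D"
      proof -
        have yh': "y \<noteq> h'" using yg jD by (simp add: g_def)
        have "D + 1 \<le> d y" using dy jD by simp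
        then obtain e f where ef: "e \<in> {1, -1}" "f \<in> {1, -1}"
          "D + 1 \<le> d (fst h' + e, snd h')" "D + 1 \<le> d (fst h', snd h' + f)"
          using two_deep_neighbours[of "D + 1" a b n h' y] h'(2) yh' unfolding d_def by auto
        have far: "D + 1 \<le> u z" if "nn h' z" "D + 1 \<le> d z" for z
        proof -
          have "z \<noteq> h'" using that(1) by (auto simp: nn_def)
          then show ?thesis using deep[of z] that(2) jD by (simp add: g_def)
        qed
        have "D - 1 \<le> u h" using IH[of h] jD by (simp add: D_def)
        moreover have any: "D \<le> u z" if "nn h' z" "z \<noteq> h" for z
        proof -
          have "D \<le> d z" using lip[OF that(1)] h'(2) by simp
          then show ?thesis using IH[of z] jD that(2) by (simp add: min_absorb2)
        qed
        moreover have "D + 1 \<le> u (fst h' + e, snd h')" "D + 1 \<le> u (fst h', snd h' + f)"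
          using ef far[of "(fst h' + e, snd h')"] far[of "(fst h', snd h' + f)"] by (auto simp: nn_def)
        ultimately have "4 * D + 1 \<le> neighbour_sum u h'"
          using neighbour_sum_two_higher_one_lower[of h' h D u e f] ef(1,2) by blast
        moreover have "neighbour_sum u h' \<le> 4 * u h'"
          using super[of h'] h' D1 yh' hh' by (auto simp: d_def)
        ultimately show ?thesis using jD by simp
      qed
      have deep': "j + 1 \<le> u w" if "j + 1 \<le> d w" "w \<noteq> h" for w
        using deep[of w] inner that by (cases "w = h'"; cases "j = D") (simp_all add: g_def)
      \<comment> \<open>Recovering the bound at \<open>h\<close>: the hole absorbs 3 grains, so four neighbours of value \<open>c\<close> force the
        value \<open>c\<close>; for \<open>j = D\<close> the higher inner neighbour makes up for the lower outer one.\<close>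
      have at_hole: "min D (j + 1) - (if j + 1 = D then 1 else 0) \<le> u h"
      proof -
        consider "j + 1 < D" | "j + 1 = D" | "j = D" | "j > D" by linarith
        then show ?thesis
        proof cases
          case 1
          have "j + 1 \<le> u z" if "nn h z" for z
          proof -
            have "z \<noteq> h" using that by (auto simp: nn_def)
            then show ?thesis using lip[OF that] deep'[of z] 1 by (simp add: D_def)
          qed
          then have "4 * (j + 1) \<le> neighbour_sum u h" by (rule neighbour_sum_lower)
          then show ?thesis using hole 1 by simp
        next
          case 2
          then show ?thesis using IH[of h] by (simp add: D_def)
        next
          case 3
          have "d z \<le> u z" if "nn h z" for z
          proof -
            have "z \<noteq> h" using that by (auto simp: nn_def)
            moreover have "d z \<le> D + 1" using lip[OF that] by (simp add: D_def)
            ultimately show ?thesis using IH[of z] deep'[of z] 3 by (cases "d z \<le> D") auto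
          qed
          then have "neighbour_sum d h \<le> neighbour_sum u h"
            unfolding neighbour_sum_def by (intro add_mono) (simp_all add: nn_cases)
          then show ?thesis using hole harm 3 by simp
        next
          case 4
          then show ?thesis using IH[of h] by (simp add: D_def)
        qed
      qed
      show "\<forall>w. min (d w) (j + 1) - (if w = h \<and> j + 1 = D then 1 else 0) \<le> u w"
      proof
        fix w
        show "min (d w) (j + 1) - (if w = h \<and> j + 1 = D then 1 else 0) \<le> u w"
        proof (cases "w = h")
          case True
          then show ?thesis using at_hole by (simp add: D_def)
        next
          case False
          then show ?thesis using IH[of w] deep'[of w] by (cases "j + 1 \<le> d w") auto
        qed
      qed
    qed
  qed
  have "min (d w) J - (if w = h \<and> J = D then 1 else 0) \<le> u w"
    using levels[of J] J_pos by (meson order_refl order_trans zero_le_one)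
  then show ?thesis
    using nonneg[of w] D1 unfolding wave_count_def J_def[symmetric] d_def[symmetric] D_def[symmetric]
    by (auto simp: D_def)
qed

lemma min_midpoint:
  fixes x :: int
  assumes "x + x' \<le> 2 * y" "z + z' \<le> 2 * t"
  shows "min x z + min x' z' \<le> 2 * min y t"
  using assms by (auto simp: min_def)

text \<open>
  The capped depth is superharmonic because it is concave along each axis, being a minimum of affine functions.
\<close>

lemma neighbour_sum_capped_depth: "neighbour_sum (\<lambda>w. min (depth a b n w) c) w \<le> 4 * min (depth a b n w) c"
proof -
  obtain i j where w: "w = (i, j)" by (cases w)
  have "min (depth a b n (i + 1, j)) c + min (depth a b n (i - 1, j)) c \<le> 2 * min (depth a b n (i, j)) c"
    unfolding depth_def by (intro min_midpoint) simp_all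
  moreover have "min (depth a b n (i, j + 1)) c + min (depth a b n (i, j - 1)) c \<le> 2 * min (depth a b n (i, j)) c"
    unfolding depth_def by (intro min_midpoint) simp_all
  ultimately show ?thesis unfolding neighbour_sum_def w by simp
qed

lemma neighbour_sum_upper:
  fixes u :: "vertex \<Rightarrow> int"
  assumes "\<And>z. nn w z \<Longrightarrow> u z \<le> c" "nn w z" "u z < c"
  shows "neighbour_sum u w < 4 * c"
  using assms(1)[of "(fst w + 1, snd w)"] assms(1)[of "(fst w - 1, snd w)"]
    assms(1)[of "(fst w, snd w + 1)"] assms(1)[of "(fst w, snd w - 1)"] assms(2,3)
  unfolding neighbour_sum_def nn_cases by auto

lemma neighbour_sum_cong: "(\<And>z. nn w z \<Longrightarrow> u z = u' z) \<Longrightarrow> neighbour_sum u w = neighbour_sum u' w"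
  unfolding neighbour_sum_def nn_cases by simp

text \<open>
  These six bounds say that \<open>wave_count\<close> stabilizes the square: values 3 on critical vertices, 4 at \<open>y\<close>, 0 at
  \<open>h\<close>, and at most 2 just outside. Superharmonicity comes from the capped depth. The extra unit needed at
  \<open>y\<close> is supplied by a neighbour with one toppling less: an outward neighbour if the cap is the depth of
  \<open>y\<close>, and \<open>h\<close> if \<open>y\<close> is its inner neighbour.
\<close>

lemma wave_count_stabilizing:
  assumes h: "1 \<le> depth a b n h" and y: "y \<noteq> h" "1 \<le> depth a b n y"
  shows "0 \<le> wave_count a b n h y w"
    and "depth a b n w \<le> 0 \<Longrightarrow> wave_count a b n h y w = 0"
    and "1 \<le> depth a b n w \<Longrightarrow> w \<noteq> h \<Longrightarrow> w \<noteq> y \<Longrightarrow>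
      neighbour_sum (wave_count a b n h y) w \<le> 4 * wave_count a b n h y w"
    and "neighbour_sum (wave_count a b n h y) y + 1 \<le> 4 * wave_count a b n h y y"
    and "neighbour_sum (wave_count a b n h y) h - 3 \<le> 4 * wave_count a b n h y h"
    and "depth a b n w \<le> 0 \<Longrightarrow> neighbour_sum (wave_count a b n h y) w \<le> 1"
proof -
  define d where "d = depth a b n"
  define D where "D = d h"
  define J where "J = reach a b n h y"
  define T where "T = wave_count a b n h y"
  define M where "M = (\<lambda>w. max 0 (min (d w) J))"
  have J: "J = (if nn h y \<and> D < d y then D else d y)"
    by (simp add: J_def reach_def D_def d_def)
  have D1: "1 \<le> D" and y1: "1 \<le> d y" using h y by (simp_all add: D_def d_def)
  have J1: "1 \<le> J" "J \<le> d y" using J D1 y1 by auto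
  have lip: "d w - 1 \<le> d z \<and> d z \<le> d w + 1" if "nn w z" for w z
    using depth_nn[OF that] unfolding d_def .
  have T: "T w = M w - (if w = h \<and> J = D then 1 else 0)" for w
    unfolding T_def wave_count_def M_def J_def D_def d_def by simp
  have TM: "T w \<le> M w" for w unfolding T by simp
  have Th: "T h = (if J = D then D - 1 else min D J)"
    using D1 J1 by (simp add: T M_def D_def[symmetric])
  show nonneg: "0 \<le> wave_count a b n h y w" for w
    unfolding T_def[symmetric] using Th D1 J1 by (cases "w = h") (auto simp: T M_def)
  show "wave_count a b n h y w = 0" if "depth a b n w \<le> 0" for w
    unfolding T_def[symmetric] using that D1 by (auto simp: T M_def d_def[symmetric] D_def)
  have super: "neighbour_sum T w \<le> 4 * M w" if "1 \<le> d w" for w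
  proof -
    have "neighbour_sum M w = neighbour_sum (\<lambda>w. min (d w) J) w"
    proof (rule neighbour_sum_cong)
      fix z assume "nn w z"
      then have "0 \<le> d z" using lip that by fastforce
      then show "M z = min (d z) J" using J1 by (simp add: M_def)
    qed
    also have "\<dots> \<le> 4 * M w"
      using neighbour_sum_capped_depth[of a b n J w] that J1 by (simp add: M_def d_def)
    finally show ?thesis using neighbour_sum_mono[where u = T and T = M and w = w, OF TM] by linarith
  qed
  have strict: "neighbour_sum T w < 4 * J" if w: "d w = J" for w
  proof -
    obtain z where z: "nn w z" "d z = J - 1"
      using outward_neighbour[of w a b n] w unfolding d_def by metis
    have le: "T z \<le> J" for z using TM[of z] J1 by (simp add: M_def)
    have "T z < J" using TM[of z] z J1 by (simp add: M_def)
    then show ?thesis using neighbour_sum_upper[of w T J z] le z by blast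
  qed
  show "neighbour_sum (wave_count a b n h y) w \<le> 4 * wave_count a b n h y w"
    if "1 \<le> depth a b n w" "w \<noteq> h" "w \<noteq> y"
    using super[of w] that unfolding T_def[symmetric] by (simp add: T d_def)
  have Ty: "T y = J" using y J1 by (simp add: T M_def)
  show "neighbour_sum (wave_count a b n h y) y + 1 \<le> 4 * wave_count a b n h y y"
  proof -
    have "neighbour_sum T y < 4 * J"
    proof (cases "d y = J")
      case True
      then show ?thesis by (rule strict)
    next
      case False
      then have "nn h y" "J = D" using J by (auto split: if_splits)
      moreover have "T z \<le> J" for z using TM[of z] J1 by (simp add: M_def)
      ultimately show ?thesis using neighbour_sum_upper[of y T J h] Th nn_sym by auto
    qed
    then show ?thesis using Ty unfolding T_def[symmetric] by simp
  qed
  show "neighbour_sum (wave_count a b n h y) h - 3 \<le> 4 * wave_count a b n h y h"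
  proof (cases "J = D")
    case True
    then show ?thesis using strict[of h] Th unfolding T_def[symmetric] by (simp add: D_def)
  next
    case False
    then show ?thesis using super[of h] D1 unfolding T_def[symmetric] by (simp add: D_def T)
  qed
  show "neighbour_sum (wave_count a b n h y) w \<le> 1" if "depth a b n w \<le> 0"
  proof -
    obtain i j where w: "w = (i, j)" by (cases w)
    have le: "T z \<le> (if 1 \<le> d z then 1 else 0)" if "nn w z" for z
      using TM[of z] lip[OF that] \<open>depth a b n w \<le> 0\<close> J1 by (auto simp: M_def d_def[symmetric])
    have out: "\<not> 1 \<le> d (i, j)" using that unfolding w d_def by simp
    have "neighbour_sum T w \<le> neighbour_sum (\<lambda>z. if 1 \<le> d z then 1 else 0) w"
      unfolding neighbour_sum_def by (intro add_mono le) (simp_all add: nn_cases)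
    also have "\<dots> \<le> 1"
    proof -
      define X where "X = {a..a + n - 1}"
      define Y where "Y = {b..b + n - 1}"
      have inside: "1 \<le> d (x, x') \<longleftrightarrow> x \<in> X \<and> x' \<in> Y" for x x'
        unfolding d_def depth_ge_iff X_def Y_def by auto
      have "i \<notin> X \<and> \<not> (i + 1 \<in> X \<and> i - 1 \<in> X) \<or> j \<notin> Y \<and> \<not> (j + 1 \<in> Y \<and> j - 1 \<in> Y)"
        using out unfolding inside X_def Y_def by auto
      then show ?thesis unfolding neighbour_sum_def w by (auto simp: inside)
    qed
    finally show ?thesis unfolding T_def .
  qed
qed

section \<open>Rings are layers\<close>

lemma outer_neighbours_card:
  assumes "p < q" "r < t" and v: "(i, j) \<in> {p..q} \<times> {r..t}"
  shows "card {w. nn (i, j) w \<and> w \<notin> {p..q} \<times> {r..t}} =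
    (if i \<in> {p, q} then 1 else 0) + (if j \<in> {r, t} then 1 else 0)"
proof -
  have "{w. nn (i, j) w \<and> w \<notin> {p..q} \<times> {r..t}} =
     (if i = p then {(p - 1, j)} else if i = q then {(q + 1, j)} else {}) \<union>
     (if j = r then {(i, r - 1)} else if j = t then {(i, t + 1)} else {})"
    using assms unfolding nn_cases by (auto split: if_splits)
  also have "card \<dots> = (if i \<in> {p, q} then 1 else 0) + (if j \<in> {r, t} then 1 else 0)"
    using assms by (subst card_Un_disjoint) auto
  finally show ?thesis .
qed

definition core :: "int \<Rightarrow> int \<Rightarrow> int \<Rightarrow> int \<Rightarrow> vertex set" where
  "core a b n l = {w. l \<le> depth a b n w}"

lemma core_eq: "core a b n l = {a + l - 1..a + n - l} \<times> {b + l - 1..b + n - l}"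
proof -
  have eq: "c + l - 1 + (n + 1 - 2 * l) = c + n - l" for c :: int by simp
  show ?thesis unfolding core_def depth_ge_iff eq by auto
qed

lemma outer_neighbours_core:
  assumes "2 * l < n + 1" "w \<in> core a b n l"
  shows "card {z. nn w z \<and> z \<notin> core a b n l} =
    (if fst w \<in> {a + l - 1, a + n - l} then 1 else 0) + (if snd w \<in> {b + l - 1, b + n - l} then 1 else 0)"
  using outer_neighbours_card[of "a + l - 1" "a + n - l" "b + l - 1" "b + n - l" "fst w" "snd w"] assms
  unfolding core_eq by simp

lemma boundary_core:
  assumes "2 * l < n + 1"
  shows "inner_boundary (core a b n l) \<union> corners (core a b n l) = {w. depth a b n w = l}"
proof -
  have "w \<in> inner_boundary (core a b n l) \<union> corners (core a b n l) \<longleftrightarrow> depth a b n w = l" for w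
  proof (cases "w \<in> core a b n l")
    case True
    have "w \<in> inner_boundary (core a b n l) \<union> corners (core a b n l) \<longleftrightarrow>
        fst w \<in> {a + l - 1, a + n - l} \<or> snd w \<in> {b + l - 1, b + n - l}"
      using True outer_neighbours_core[OF assms True] unfolding inner_boundary_def corners_def by auto
    also have "\<dots> \<longleftrightarrow> w \<notin> core a b n (l + 1)"
      using True unfolding core_eq by (cases w) auto
    also have "\<dots> \<longleftrightarrow> depth a b n w = l"
      using True by (auto simp: core_def)
    finally show ?thesis .
  next
    case False
    then show ?thesis by (auto simp: inner_boundary_def corners_def core_def)
  qed
  then show ?thesis by blast
qed

lemma corner_core:
  assumes "2 * l < n + 1" "depth a b n w = l" "w \<notin> corners (core a b n l)"
  shows "\<not> layer_corner a b n w"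
proof -
  have w: "w \<in> core a b n l" using assms(2) by (simp add: core_def)
  show ?thesis
    using assms outer_neighbours_core[OF assms(1) w] w
    unfolding corners_def layer_corner_def by auto
qed

lemma num_rings_eq: "num_rings N = (N + 1) div 2"
proof -
  have "\<lceil>real N / 2\<rceil> = int ((N + 1) div 2)"
    by (cases "even N") (auto elim!: evenE oddE intro!: ceiling_unique)
  then show ?thesis unfolding num_rings_def by simp
qed

text \<open>
  Downward induction on \<open>j\<close>: removing the rings beyond \<open>j\<close> leaves the vertices of depth at least \<open>num_rings N - j + 1\<close>.
  For \<open>j = 1\<close> these are a single layer since no depth exceeds \<open>num_rings N\<close>.
\<close>

lemma ring_eq_layer:
  assumes "1 \<le> j" "j \<le> num_rings N"
  shows "ring N (core a b (int N) 1) j = {w. depth a b (int N) w = int (num_rings N) - int j + 1}"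
  using assms
proof (induction "num_rings N - j" arbitrary: j rule: less_induct)
  case less
  define m where "m = num_rings N"
  define l where "l = int m - int j + 1"
  have IH: "ring N (core a b (int N) 1) k = {w. depth a b (int N) w = int m - int k + 1}"
    if "k \<in> {j<..m}" for k
    using less.hyps[of k] that less.prems unfolding m_def by auto
  have rest: "core a b (int N) 1 - (\<Union>k\<in>{j<..m}. ring N (core a b (int N) 1) k) = core a b (int N) l"
  proof -
    have "(\<Union>k\<in>{j<..m}. ring N (core a b (int N) 1) k) = {w. 1 \<le> depth a b (int N) w \<and> depth a b (int N) w < l}"
    proof (intro set_eqI iffI)
      fix w assume "w \<in> (\<Union>k\<in>{j<..m}. ring N (core a b (int N) 1) k)"
      then show "w \<in> {w. 1 \<le> depth a b (int N) w \<and> depth a b (int N) w < l}"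
        using IH by (auto simp: l_def)
    next
      fix w assume w: "w \<in> {w. 1 \<le> depth a b (int N) w \<and> depth a b (int N) w < l}"
      define k where "k = nat (int m + 1 - depth a b (int N) w)"
      have "k \<in> {j<..m}" using w by (auto simp: k_def l_def)
      moreover have "depth a b (int N) w = int m - int k + 1" using w by (auto simp: k_def l_def)
      ultimately show "w \<in> (\<Union>k\<in>{j<..m}. ring N (core a b (int N) 1) k)" using IH by blast
    qed
    then show ?thesis using less.prems by (auto simp: core_def l_def m_def)
  qed
  have ring: "ring N (core a b (int N) 1) j = (if j = 1 then core a b (int N) l
      else inner_boundary (core a b (int N) l) \<union> corners (core a b (int N) l))"
    by (subst ring.simps) (simp only: Let_def rest[unfolded m_def])
  show ?case
  proof (cases "j = 1")
    case True
    have "2 * int m \<ge> int N" unfolding m_def num_rings_eq by linarith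
    then have "depth a b (int N) w \<le> l" for w
      using depth_le[of a b "int N" w] True unfolding l_def m_def num_rings_eq by auto
    then show ?thesis using True ring unfolding core_def l_def m_def by (auto intro: antisym)
  next
    case False
    then have "2 \<le> j" using less.prems by simp
    then have "2 * l < int N + 1" unfolding l_def m_def num_rings_eq by presburger
    then show ?thesis using False ring boundary_core unfolding l_def m_def by simp
  qed
qed

lemma union_rings_eq_core:
  assumes "1 \<le> k" "k \<le> num_rings N"
  shows "(\<Union>j\<in>{1..k}. ring N (core a b (int N) 1) j) = core a b (int N) (int (num_rings N) - int k + 1)"
proof (intro set_eqI iffI)
  fix w assume "w \<in> (\<Union>j\<in>{1..k}. ring N (core a b (int N) 1) j)"
  then show "w \<in> core a b (int N) (int (num_rings N) - int k + 1)"
    using ring_eq_layer[of _ N a b] assms by (auto simp: core_def)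
next
  fix w assume w: "w \<in> core a b (int N) (int (num_rings N) - int k + 1)"
  define j where "j = nat (int (num_rings N) + 1 - depth a b (int N) w)"
  have "depth a b (int N) w \<le> int (num_rings N)"
    using depth_le[of a b "int N" w] unfolding num_rings_eq by linarith
  then have "j \<in> {1..k}" "depth a b (int N) w = int (num_rings N) - int j + 1"
    using w by (auto simp: j_def core_def)
  then show "w \<in> (\<Union>j\<in>{1..k}. ring N (core a b (int N) 1) j)"
    using ring_eq_layer[of j N a b] assms by auto
qed

section \<open>Summing the toppling numbers\<close>

lemma telescoping_sum:
  fixes f g :: "int \<Rightarrow> int"
  assumes "\<And>x. g x - g (x - 2) = f x" and "0 \<le> c"
  shows "(\<Sum>i\<in>{1..c}. f (n + 2 - 2 * i)) = g n - g (n - 2 * c)"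
  using assms(2)
proof (induction c rule: int_ge_induct)
  case (step c)
  have "{1..c + 1} = insert (c + 1) {1..c}" using step.hyps by auto
  moreover have "n + 2 - 2 * (c + 1) = n - 2 * c" "n - 2 * (c + 1) = n - 2 * c - 2" by simp_all
  ultimately show ?case using step.IH assms(1)[of "n - 2 * c"]
    by (simp add: diff_diff_eq)
qed simp

lemma finite_core: "finite (core a b n l)"
  unfolding core_eq by simp

lemma card_core:
  assumes "2 * l \<le> n + 2"
  shows "int (card (core a b n l)) = (n + 2 - 2 * l)\<^sup>2"
  using assms unfolding core_eq by (simp add: card_cartesian_product power2_eq_square algebra_simps)

lemma min_as_sum_over_levels:
  assumes "0 \<le> x" "0 \<le> (c::int)"
  shows "min x c = (\<Sum>i\<in>{1..c}. if i \<le> x then 1 else 0)"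
proof -
  have "(\<Sum>i\<in>{1..c}. if i \<le> x then 1 else 0) = int (card {i \<in> {1..c}. i \<le> x})"
    by (simp add: sum.If_cases Int_def)
  also have "{i \<in> {1..c}. i \<le> x} = {1..min x c}" by auto
  finally show ?thesis using assms by simp
qed

lemma sum_over_core_by_levels:
  assumes "1 \<le> l"
  shows "(\<Sum>w\<in>core a b n 1. if l \<le> depth a b n w then (x::int) else 0) = int (card (core a b n l)) * x"
proof -
  have "{w \<in> core a b n 1. l \<le> depth a b n w} = core a b n l"
    using assms by (auto simp: core_def)
  then show ?thesis by (simp add: sum.If_cases finite_core Int_def)
qed

text \<open>
  Layer-cake summation: \<open>min (d w) c\<close> counts the levels \<open>i \<le> c\<close> that \<open>w\<close> reaches, and level \<open>i\<close> is reached
  by a square of side \<open>n + 2 - 2 i\<close>.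
\<close>

lemma sum_capped_depth:
  assumes "0 \<le> c" "2 * c \<le> n + 2"
  shows "(\<Sum>w\<in>core a b n 1. min (depth a b n w) c) = (\<Sum>i\<in>{1..c}. (n + 2 - 2 * i)\<^sup>2)"
proof -
  have "(\<Sum>w\<in>core a b n 1. min (depth a b n w) c) =
      (\<Sum>w\<in>core a b n 1. \<Sum>i\<in>{1..c}. if i \<le> depth a b n w then 1 else 0)"
    using assms by (intro sum.cong min_as_sum_over_levels) (auto simp: core_def)
  also have "\<dots> = (\<Sum>i\<in>{1..c}. \<Sum>w\<in>core a b n 1. if i \<le> depth a b n w then 1 else 0)"
    by (rule sum.swap)
  also have "\<dots> = (\<Sum>i\<in>{1..c}. (n + 2 - 2 * i)\<^sup>2)"
    using assms by (intro sum.cong refl) (simp add: sum_over_core_by_levels card_core)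
  finally show ?thesis .
qed

text \<open>
  The same idea for pairs: both points reach level \<open>i\<close> exactly for pairs from the square of that level, hence the fourth power.
\<close>

lemma sum_sum_min_depth:
  assumes "0 \<le> c" "2 * c \<le> n + 2" and deep: "\<And>w. depth a b n w \<le> c"
  shows "(\<Sum>y\<in>core a b n 1. \<Sum>w\<in>core a b n 1. min (depth a b n w) (depth a b n y)) =
    (\<Sum>i\<in>{1..c}. (n + 2 - 2 * i) ^ 4)"
proof -
  have "(\<Sum>w\<in>core a b n 1. min (depth a b n w) (depth a b n y)) =
      (\<Sum>i\<in>{1..c}. if i \<le> depth a b n y then (n + 2 - 2 * i)\<^sup>2 else 0)" if "y \<in> core a b n 1" for y
  proof -
    have "(\<Sum>w\<in>core a b n 1. min (depth a b n w) (depth a b n y)) =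
        (\<Sum>i\<in>{1..depth a b n y}. (n + 2 - 2 * i)\<^sup>2)"
      using that depth_le[of a b n y] by (intro sum_capped_depth) (auto simp: core_def)
    also have "{1..depth a b n y} = {i \<in> {1..c}. i \<le> depth a b n y}" using deep[of y] by auto
    finally show ?thesis by (simp add: sum.If_cases Int_def)
  qed
  then have "(\<Sum>y\<in>core a b n 1. \<Sum>w\<in>core a b n 1. min (depth a b n w) (depth a b n y)) =
      (\<Sum>y\<in>core a b n 1. \<Sum>i\<in>{1..c}. if i \<le> depth a b n y then (n + 2 - 2 * i)\<^sup>2 else 0)"
    by simp
  also have "\<dots> = (\<Sum>i\<in>{1..c}. \<Sum>y\<in>core a b n 1. if i \<le> depth a b n y then (n + 2 - 2 * i)\<^sup>2 else 0)"
    by (rule sum.swap)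
  also have "\<dots> = (\<Sum>i\<in>{1..c}. (n + 2 - 2 * i) ^ 4)"
    using assms by (intro sum.cong refl) (simp add: sum_over_core_by_levels card_core power2_eq_square power4_eq_xxxx mult.assoc)
  finally show ?thesis .
qed

lemma card_layer:
  assumes "2 * l \<le> n"
  shows "int (card {w. depth a b n w = l}) = 4 * (n + 1 - 2 * l)"
proof -
  have "{w. depth a b n w = l} = core a b n l - core a b n (l + 1)" by (auto simp: core_def)
  moreover have "core a b n (l + 1) \<subseteq> core a b n l" by (auto simp: core_def)
  ultimately have "card {w. depth a b n w = l} = card (core a b n l) - card (core a b n (l + 1))"
    using card_Diff_subset finite_core by metis
  moreover have "card (core a b n (l + 1)) \<le> card (core a b n l)"
    using \<open>core a b n (l + 1) \<subseteq> core a b n l\<close> finite_core card_mono by blast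
  ultimately have "int (card {w. depth a b n w = l}) = (n + 2 - 2 * l)\<^sup>2 - (n + 2 - 2 * (l + 1))\<^sup>2"
    using card_core[of l n a b] card_core[of "l + 1" n a b] assms by simp
  then show ?thesis by (simp add: power2_eq_square algebra_simps)
qed

text \<open>
  With \<open>F c\<close> the sum of the capped depths, a start at \<open>y\<close> gives \<open>F (d y)\<close> topplings, less one if
  \<open>d y = D\<close>. The start at the inner neighbour gives \<open>F D - 1\<close> instead of \<open>F (D + 1)\<close>, and the omitted start
  at \<open>h\<close> would have contributed \<open>F D - 1\<close>; both corrections together remove exactly \<open>F (D + 1)\<close>.
\<close>

lemma total_wave_count:
  assumes noncorner: "\<not> layer_corner a b n h" and h: "1 \<le> depth a b n h"
    and c: "0 \<le> c" "2 * c \<le> n + 2" "\<And>w. depth a b n w \<le> c"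
  shows "(\<Sum>y\<in>core a b n 1 - {h}. \<Sum>w\<in>core a b n 1. wave_count a b n h y w) =
    (\<Sum>i\<in>{1..c}. (n + 2 - 2 * i) ^ 4) - (\<Sum>i\<in>{1..depth a b n h + 1}. (n + 2 - 2 * i)\<^sup>2)
    - 4 * (n + 1 - 2 * depth a b n h)"
proof -
  define d where "d = depth a b n"
  define D where "D = d h"
  define A where "A = core a b n 1"
  define F where "F = (\<lambda>c. \<Sum>w\<in>A. min (d w) c)"
  have D1: "1 \<le> D" using h by (simp add: D_def d_def)
  have fin: "finite A" unfolding A_def by (rule finite_core)
  have A: "w \<in> A \<longleftrightarrow> 1 \<le> d w" for w by (simp add: A_def core_def d_def)
  obtain h' where h': "nn h h'" "d h' = D + 1" and unique: "\<And>w. nn h w \<Longrightarrow> d w \<ge> D + 1 \<Longrightarrow> w = h'"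
    by (rule inner_neighbour[OF noncorner, folded d_def, folded D_def]) blast
  have hA: "h \<in> A" "h' \<in> A - {h}" using h' D1 by (auto simp: A D_def)
  have room: "2 * (D + 1) \<le> n + 1" using depth_le[of a b n h'] h'(2) by (simp add: d_def)
  have one: "(\<Sum>w\<in>A. wave_count a b n h y w) = F (d y) - (if d y = D then 1 else 0)
      - (if y = h' then F (D + 1) - F D + 1 else 0)" if y: "y \<in> A - {h}" for y
  proof -
    define J where "J = reach a b n h y"
    have J: "J = (if y = h' then D else d y)"
    proof -
      have "nn h y \<and> D < d y \<longleftrightarrow> y = h'" using h' unique[of y] by fastforce
      then show ?thesis unfolding J_def reach_def d_def[symmetric] D_def[symmetric] by simp
    qed
    have "(\<Sum>w\<in>A. wave_count a b n h y w) = (\<Sum>w\<in>A. min (d w) J - (if w = h then (if J = D then 1 else 0) else 0))"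
    proof (rule sum.cong)
      fix w assume "w \<in> A"
      moreover have "1 \<le> J" using J y D1 by (auto simp: A)
      ultimately show "wave_count a b n h y w = min (d w) J - (if w = h then (if J = D then 1 else 0) else 0)"
        unfolding wave_count_def J_def[symmetric] d_def[symmetric] D_def[symmetric] by (auto simp: A)
    qed simp
    also have "\<dots> = F J - (if J = D then 1 else 0)"
      unfolding F_def using hA fin by (simp add: sum_subtractf)
    finally show ?thesis using J h' by simp
  qed
  have "(\<Sum>y\<in>A - {h}. \<Sum>w\<in>A. wave_count a b n h y w) =
      (\<Sum>y\<in>A - {h}. F (d y) - (if d y = D then 1 else 0)) - (F (D + 1) - F D + 1)"
    using one hA fin by (simp add: sum_subtractf)
  also have "(\<Sum>y\<in>A - {h}. F (d y) - (if d y = D then 1 else 0)) =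
      (\<Sum>y\<in>A. F (d y) - (if d y = D then 1 else 0)) - (F D - 1)"
    using hA fin by (simp add: sum_diff1 D_def)
  also have "(\<Sum>y\<in>A. F (d y) - (if d y = D then 1 else 0)) = (\<Sum>y\<in>A. F (d y)) - int (card {w. d w = D})"
  proof -
    have "{w \<in> A. d w = D} = {w. d w = D}" using D1 by (auto simp: A)
    then show ?thesis using fin by (simp add: sum_subtractf sum.If_cases Int_def)
  qed
  also have "int (card {w. d w = D}) = 4 * (n + 1 - 2 * D)"
    unfolding d_def by (rule card_layer) (use room in simp)
  also have "(\<Sum>y\<in>A. F (d y)) = (\<Sum>i\<in>{1..c}. (n + 2 - 2 * i) ^ 4)"
    unfolding F_def A_def d_def by (rule sum_sum_min_depth[OF c])
  finally have "(\<Sum>y\<in>A - {h}. \<Sum>w\<in>A. wave_count a b n h y w) =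
      (\<Sum>i\<in>{1..c}. (n + 2 - 2 * i) ^ 4) - F (D + 1) - 4 * (n + 1 - 2 * D)" by simp
  moreover have "F (D + 1) = (\<Sum>i\<in>{1..D + 1}. (n + 2 - 2 * i)\<^sup>2)"
    unfolding F_def A_def d_def by (rule sum_capped_depth) (use D1 room in simp_all)
  ultimately show ?thesis unfolding A_def D_def d_def by simp
qed

section \<open>Avalanches in a square generator with a hole\<close>

text \<open>
  Maximality of a generator keeps its surroundings low: a critical neighbour could be added to it.
\<close>

lemma generator_neighbour_not_critical:
  assumes gen: "generator L \<eta> A" and w: "w \<in> V L" "w \<notin> A" and z: "z \<in> A" "nn w z"
  shows "\<eta> w \<noteq> 3"
proof
  assume "\<eta> w = 3"
  define r where "r = (\<lambda>B a b. a \<in> B \<and> b \<in> B \<and> nn a b)"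
  have conn: "(r A)\<^sup>*\<^sup>* x x'" if "x \<in> A" "x' \<in> A" for x x'
    using gen that unfolding generator_def lattice_connected_def r_def by blast
  have step: "r (insert w A) w z" "r (insert w A) z w" using z nn_sym by (auto simp: r_def)
  have old: "(r (insert w A))\<^sup>*\<^sup>* x x'" if "x \<in> A" "x' \<in> A" for x x'
    by (rule rtranclp_mono[THEN predicate2D, OF _ conn[OF that]]) (auto simp: r_def)
  have "(r (insert w A))\<^sup>*\<^sup>* x x'" if "x \<in> insert w A" "x' \<in> insert w A" for x x'
  proof -
    have "(r (insert w A))\<^sup>*\<^sup>* x z" using that(1) step old[OF _ z(1)] by blast
    moreover have "(r (insert w A))\<^sup>*\<^sup>* z x'" using that(2) step old[OF z(1)] by blast
    ultimately show ?thesis by (rule rtranclp_trans)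
  qed
  then have "lattice_connected (insert w A)" unfolding lattice_connected_def r_def by blast
  moreover have "insert w A \<subseteq> critical L \<eta>"
    using gen w \<open>\<eta> w = 3\<close> unfolding generator_def critical_def by blast
  ultimately show False using gen w(2) unfolding generator_def by blast
qed

text \<open>
  On the square, being a stabilizing function amounts to the superharmonicity conditions of
  \<open>wave_count_le_superharmonic\<close>. Outside, a vertex next to the square holds at most 2 grains and receives at most one, so the avalanche
  stays in the square.
\<close>

lemma avalanche_size_removal:
  assumes \<eta>: "\<eta> \<in> Omega L" and gen: "generator L \<eta> (core a b n 1)"
    and noncorner: "\<not> layer_corner a b n h" and h: "h \<in> core a b n 1"
    and y: "y \<in> core a b n 1"
  shows "int (avalanche_size L (removal h \<eta>) y) =
    (if y = h then 0 else \<Sum>w\<in>core a b n 1. wave_count a b n h y w)"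
proof -
  define A where "A = core a b n 1"
  define \<sigma> where "\<sigma> = add_grain y (removal h \<eta>)"
  have A: "w \<in> A \<longleftrightarrow> 1 \<le> depth a b n w" for w by (simp add: A_def core_def)
  have AV: "A \<subseteq> V L" and crit: "\<And>w. w \<in> A \<Longrightarrow> \<eta> w = 3"
    using gen unfolding generator_def critical_def A_def by blast+
  have range: "0 \<le> \<eta> w \<and> \<eta> w \<le> 3" if "w \<in> V L" for w
    using PiE_mem[OF \<eta>[unfolded Omega_def] that] by simp
  have hy: "h \<in> A" "y \<in> A" using h y by (simp_all add: A_def)
  have \<sigma>: "\<sigma> w = (if w = h then 0 else \<eta> w) + (if w = y then 1 else 0)" for w
    unfolding \<sigma>_def add_grain_def removal_def by simp
  have config: "\<sigma> \<in> V L \<rightarrow>\<^sub>E {0..}"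
  proof (rule PiE_I)
    show "\<sigma> w \<in> {0..}" if "w \<in> V L" for w using range[OF that] by (simp add: \<sigma>)
    show "\<sigma> w = undefined" if "w \<notin> V L" for w
    proof -
      have "w \<noteq> h" "w \<noteq> y" using that hy AV by auto
      then show ?thesis using PiE_arb[OF \<eta>[unfolded Omega_def] that] by (simp add: \<sigma>)
    qed
  qed
  show ?thesis
  proof (cases "y = h")
    case True
    have "int (avalanche_size L (removal h \<eta>) y) = sum (\<lambda>_. 0) (V L)"
    proof (rule avalanche_size_eq_least_stabilizer[of y "removal h \<eta>" L, folded \<sigma>_def, OF config])
      show "stabilizes L \<sigma> (\<lambda>_. 0)"
        using range True unfolding stabilizes_def by (auto simp: neighbour_sum_def \<sigma>)
      show "0 \<le> u w" if "stabilizes L \<sigma> u" for u w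
        using that unfolding stabilizes_def by blast
    qed
    then show ?thesis using True by simp
  next
    case False
    have dh: "1 \<le> depth a b n h" and dy: "1 \<le> depth a b n y" using hy A by auto
    note wb = wave_count_stabilizing[OF dh False dy]
    have outside: "wave_count a b n h y w = 0" if "w \<notin> A" for w
      by (rule wb(2)) (use that in \<open>simp add: A\<close>)
    have "int (avalanche_size L (removal h \<eta>) y) = sum (wave_count a b n h y) (V L)"
    proof (rule avalanche_size_eq_least_stabilizer[of y "removal h \<eta>" L, folded \<sigma>_def, OF config])
      have "\<sigma> w - 4 * wave_count a b n h y w + neighbour_sum (wave_count a b n h y) w \<le> 3" if w: "w \<in> V L" for w
      proof (cases "w \<in> A")
        case True
        consider "w = y" | "w = h" | "w \<noteq> y" "w \<noteq> h" by blast
        then show ?thesis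
        proof cases
          case 1
          then show ?thesis using wb(4) crit[of y] hy False by (simp add: \<sigma>)
        next
          case 2
          then show ?thesis using wb(5) False by (simp add: \<sigma>)
        next
          case 3
          then show ?thesis using wb(3)[of w] crit[OF True] True by (simp add: \<sigma> A)
        qed
      next
        case out: False
        then have w0: "depth a b n w \<le> 0" by (simp add: A)
        have "w \<noteq> h" "w \<noteq> y" using out hy by auto
        then have \<sigma>w: "\<sigma> w = \<eta> w" by (simp add: \<sigma>)
        show ?thesis
        proof (cases "\<exists>z. nn w z \<and> z \<in> A")
          case True
          then have "\<eta> w \<noteq> 3" using generator_neighbour_not_critical[OF gen w] out by (auto simp: A_def)
          then have "\<eta> w \<le> 2" using range[OF w] by simp
          then show ?thesis using wb(2)[OF w0] wb(6)[OF w0] \<sigma>w by simp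
        next
          case False
          have "wave_count a b n h y z = 0" if "nn w z" for z
            using outside[of z] False that by blast
          then have "neighbour_sum (wave_count a b n h y) w = neighbour_sum (\<lambda>_. 0) w" by (rule neighbour_sum_cong)
          then show ?thesis using wb(2)[OF w0] \<sigma>w range[OF w] by (simp add: neighbour_sum_def)
        qed
      qed
      moreover have "wave_count a b n h y w = 0" if "w \<notin> V L" for w
        using outside[of w] that AV by blast
      ultimately show "stabilizes L \<sigma> (wave_count a b n h y)"
        using wb(1) unfolding stabilizes_def by blast
    next
      fix u w assume u: "stabilizes L \<sigma> u"
      have stable: "neighbour_sum u x \<le> 3 - \<sigma> x + 4 * u x" if "x \<in> A" for x
      proof -
        have "\<sigma> x - 4 * u x + neighbour_sum u x \<le> 3" using u that AV unfolding stabilizes_def by blast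
        then show ?thesis by simp
      qed
      show "wave_count a b n h y w \<le> u w"
      proof (rule wave_count_le_superharmonic[OF noncorner dh False dy])
        show "0 \<le> u w" for w using u unfolding stabilizes_def by blast
        show "neighbour_sum u x \<le> 4 * u x" if "1 \<le> depth a b n x" "x \<noteq> h" "x \<noteq> y" for x
          using stable[of x] crit[of x] that by (simp add: A \<sigma>)
        show "neighbour_sum u y + 1 \<le> 4 * u y" using stable[of y] crit[of y] hy False by (simp add: \<sigma>)
        show "neighbour_sum u h - 3 \<le> 4 * u h" using stable[of h] hy False by (simp add: \<sigma>)
      qed
    qed
    also have "\<dots> = sum (wave_count a b n h y) A"
      by (rule sum.mono_neutral_right) (use finite_V AV outside in blast)+
    finally show ?thesis using False by (simp add: A_def)
  qed
qed

lemma expected_avalanche_given_eq: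
  assumes "A \<subseteq> V L" "A \<noteq> {}"
  shows "expected_avalanche_given L \<eta> A = (\<Sum>y\<in>A. real (avalanche_size L \<eta> y)) / real (card A)"
proof -
  have fin: "finite A" using assms finite_V finite_subset by blast
  have "cond_pmf (pmf_of_set (V L)) A = pmf_of_set A"
  proof (rule pmf_eqI)
    fix x
    have ne: "V L \<noteq> {}" using assms by blast
    have meet: "set_pmf (pmf_of_set (V L)) \<inter> A \<noteq> {}"
      using assms set_pmf_of_set[OF ne finite_V] by blast
    have "measure (measure_pmf (pmf_of_set (V L))) A = real (card A) / real (card (V L))"
      using measure_pmf_of_set[OF ne finite_V, of A] assms(1) by (simp add: Int_absorb1)
    moreover have "real (card (V L)) \<noteq> 0" using ne finite_V by simp
    ultimately show "pmf (cond_pmf (pmf_of_set (V L)) A) x = pmf (pmf_of_set A) x"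
      using assms fin ne finite_V by (auto simp: pmf_cond[OF meet] indicator_def)
  qed
  then show ?thesis
    unfolding expected_avalanche_given_def using fin assms by (simp add: integral_pmf_of_set)
qed

theorem lemma4p4:
  fixes L N k :: nat and \<eta> :: sandpile and A :: "vertex set" and v :: vertex
  assumes "L \<ge> 1"
    and "N \<ge> 3"
    and "\<eta> \<in> Omega L"
    and "generator L \<eta> A"
    and "is_square N A"
    and "k \<in> {2..num_rings N}"
    and "v \<in> ring N A k - corners (\<Union>j\<in>{1..k}. ring N A j)"
  shows "expected_avalanche_given L (removal v \<eta>) A =
    (if odd N
     then (3 * real N ^ 5 + 15 * real N ^ 4 + 15 * real N ^ 3 - 15 * real N ^ 2 - 18 * real N
           + 10 * (4 * real k ^ 3 - 24 * real k ^ 2 + 23 * real k - 6)) / (30 * real N ^ 2)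
     else (3 * real N ^ 5 + 15 * real N ^ 4 + 15 * real N ^ 3 - 15 * real N ^ 2 - 18 * real N
           + 20 * real k * (2 * real k ^ 2 - 9 * real k + 1)) / (30 * real N ^ 2))"
proof -
  define n where "n = int N"
  define m where "m = int (num_rings N)"
  define D where "D = m - int k + 1"
  obtain a b where A: "A = core a b n 1"
  proof -
    obtain a b where "A = {a..<a + n} \<times> {b..<b + n}" using assms(5) unfolding is_square_def n_def by blast
    moreover have "{c..<c + n} = {c + 1 - 1..c + n - 1}" for c by auto
    ultimately show thesis using that[of a b] unfolding core_eq by simp
  qed
  have m: "2 * m = n + 1 \<and> odd N \<or> 2 * m = n \<and> even N"
    unfolding m_def n_def num_rings_eq by (cases "even N") (auto elim!: evenE oddE)
  have k: "2 \<le> int k" "int k \<le> m" using assms(6) by (auto simp: m_def)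
  have "v \<in> ring N A k" using assms(7) by blast
  then have dv: "depth a b n v = D"
    using ring_eq_layer[of k N a b] assms(6) unfolding A n_def D_def m_def by auto
  have "v \<notin> corners (core a b n D)"
    using assms(6,7) union_rings_eq_core[of k N a b] unfolding A n_def D_def m_def by auto
  then have noncorner: "\<not> layer_corner a b n v"
    using corner_core[OF _ dv] m k unfolding D_def by auto
  have vA: "v \<in> core a b n 1" using dv k by (simp add: core_def D_def)
  have AV: "A \<subseteq> V L" using assms(4) unfolding generator_def critical_def by blast
  define S where "S = (\<Sum>y\<in>A. int (avalanche_size L (removal v \<eta>) y))"
  have "S = (\<Sum>y\<in>core a b n 1. if y = v then 0 else \<Sum>w\<in>core a b n 1. wave_count a b n v y w)"
    unfolding S_def A
    by (intro sum.cong refl avalanche_size_removal[OF assms(3) assms(4)[unfolded A] noncorner vA])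
  also have "\<dots> = (\<Sum>y\<in>core a b n 1 - {v}. \<Sum>w\<in>core a b n 1. wave_count a b n v y w)"
    by (rule sum.mono_neutral_cong_right) (auto simp: finite_core)
  also have "\<dots> = (\<Sum>i\<in>{1..m}. (n + 2 - 2 * i) ^ 4) - (\<Sum>i\<in>{1..D + 1}. (n + 2 - 2 * i)\<^sup>2)
      - 4 * (n + 1 - 2 * D)"
  proof -
    have "depth a b n w \<le> m" for w using depth_le[of a b n w] m by auto
    then show ?thesis
      using total_wave_count[OF noncorner, of m] dv k m unfolding D_def by auto
  qed
  finally have S: "S = (\<Sum>i\<in>{1..m}. (n + 2 - 2 * i) ^ 4) - (\<Sum>i\<in>{1..D + 1}. (n + 2 - 2 * i)\<^sup>2)
      - 4 * (n + 1 - 2 * D)" .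
  \<comment> \<open>Antidifferences with step 2 of \<open>30 x ^ 4\<close> and \<open>6 x ^ 2\<close>. \<open>P\<close> vanishes at 0 and at -1, the values of
    \<open>n - 2 m\<close> for even and for odd \<open>N\<close>.\<close>
  define P where "P = (\<lambda>x::int. 3 * x ^ 5 + 15 * x ^ 4 + 20 * x ^ 3 - 8 * x)"
  define Q where "Q = (\<lambda>x::int. x * (x + 1) * (x + 2))"
  have "(\<Sum>i\<in>{1..m}. 30 * (n + 2 - 2 * i) ^ 4) = P n - P (n - 2 * m)"
  proof (rule telescoping_sum)
    show "P x - P (x - 2) = 30 * x ^ 4" for x unfolding P_def
      by (simp add: power_numeral_reduce algebra_simps)
  qed (use k in simp)
  moreover have "P (n - 2 * m) = 0"
  proof -
    have "n - 2 * m = 0 \<or> n - 2 * m = - 1" using m by linarith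
    then show ?thesis by (auto simp: P_def)
  qed
  ultimately have P: "30 * (\<Sum>i\<in>{1..m}. (n + 2 - 2 * i) ^ 4) = P n"
    by (simp add: sum_distrib_left)
  have "(\<Sum>i\<in>{1..D + 1}. 6 * (n + 2 - 2 * i)\<^sup>2) = Q n - Q (n - 2 * (D + 1))"
  proof (rule telescoping_sum)
    show "Q x - Q (x - 2) = 6 * x\<^sup>2" for x unfolding Q_def
      by (simp add: power_numeral_reduce algebra_simps)
  qed (use k in \<open>simp add: D_def\<close>)
  then have Q: "6 * (\<Sum>i\<in>{1..D + 1}. (n + 2 - 2 * i)\<^sup>2) = Q n - Q (n - 2 * (D + 1))"
    by (simp add: sum_distrib_left)
  have total: "30 * S = P n - 5 * (Q n - Q (n - 2 * (D + 1))) - 120 * (n + 1 - 2 * D)"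
    using S P Q by simp
  have closed: "30 * S = 3 * n ^ 5 + 15 * n ^ 4 + 15 * n ^ 3 - 15 * n ^ 2 - 18 * n
     + (if odd N then 10 * (4 * int k ^ 3 - 24 * int k ^ 2 + 23 * int k - 6)
        else 20 * int k * (2 * int k ^ 2 - 9 * int k + 1))"
  proof (cases "odd N")
    case True
    then have "2 * m = n + 1" using m by auto
    then have eqs: "n - 2 * (D + 1) = 2 * int k - 5" "n + 1 - 2 * D = 2 * int k - 2"
      unfolding D_def by simp_all
    have "30 * S = P n - 5 * (Q n - Q (2 * int k - 5)) - 120 * (2 * int k - 2)"
      using total unfolding eqs .
    then show ?thesis using True unfolding P_def Q_def
      by (simp add: power_numeral_reduce algebra_simps)
  next
    case False
    then have "2 * m = n" using m by auto
    then have eqs: "n - 2 * (D + 1) = 2 * int k - 4" "n + 1 - 2 * D = 2 * int k - 1"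
      unfolding D_def by simp_all
    have "30 * S = P n - 5 * (Q n - Q (2 * int k - 4)) - 120 * (2 * int k - 1)"
      using total unfolding eqs .
    then show ?thesis using False unfolding P_def Q_def
      by (simp add: power_numeral_reduce algebra_simps)
  qed
  have "int (card A) = n\<^sup>2" using card_core[of 1 n a b] assms(2) unfolding A n_def by simp
  then have "card A = N\<^sup>2" unfolding n_def by (metis of_nat_eq_iff of_nat_power)
  then have card: "real (card A) = real N ^ 2" by simp
  have "expected_avalanche_given L (removal v \<eta>) A = real_of_int S / real N ^ 2"
  proof -
    have "A \<noteq> {}" using vA unfolding A by blast
    then show ?thesis using expected_avalanche_given_eq[OF AV] card unfolding S_def by simp
  qed
  also have "\<dots> = real_of_int (30 * S) / (30 * real N ^ 2)" by simp
  finally show ?thesis unfolding closed n_def by simp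
qed

end
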